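(* Let $K$ be a field of characteristic different from $2$ and let $q(x)=x^4+d_3x^3+d_2x^2+d_1x+d_0$ be the 2-division quartic of a pair $(C,P_2)$ over $K$. Then $P_2$ is a 3-torsion point if and only if $-d_3/4$ is a simple root of $q$.
   Context: A pair $(C,P_2)$ over $K$ consists of a plane cubic $C = \{y^2 = x^3 + ax^2 + bx + c\}$ with $a,b,c\in K$ (together with its point at infinity $O=(0:1:0)$), which may be singular, and a $K$-rational point $P_2=(x_2,y_2)\in C(K)\setminus\{O\}$, which may be a singular point of $C$. The 2-division quartic of $(C,P_2)$ is $$x^4 - 4x_2x^3 - (2b+4ax_2)x^2 - (8c+4bx_2)x + (b^2-4ac-4cx_2)$$ (it is the same for $(C,-P_2)$, where $-P_2=(x_2,-y_2)$). The set $C_{\mathrm{sm}}$ of smooth points of $C$ is an abelian group under the chord-and-tangent law with identity $O$; "$P_2$ is a 3-torsion point" means $P_2\in C_{\mathrm{sm}}$ and $3P_2=O$. *)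

theory Defs
  imports "HOL-Computational_Algebra.Polynomial" "HOL-Algebra.Group"
begin

text \<open>
  The plane cubic \<open>y\<^sup>2 = x\<^sup>3 + a x\<^sup>2 + b x + c\<close> over a field, possibly singular, given by its
  coefficients. Its only point on the line at infinity is \<open>(0:1:0)\<close>.
\<close>

datatype 'a point = Infinity | Affine 'a 'a

definition rhs :: "'a::field \<Rightarrow> 'a \<Rightarrow> 'a \<Rightarrow> 'a poly" where
  "rhs a b c = [:c, b, a, 1:]"

definition points :: "'a::field \<Rightarrow> 'a \<Rightarrow> 'a \<Rightarrow> 'a point set" where
  "points a b c = insert Infinity {Affine x y | x y. y\<^sup>2 = x ^ 3 + a * x\<^sup>2 + b * x + c}"

text \<open>
  The two partial derivatives of \<open>y\<^sup>2 - (x\<^sup>3 + a x\<^sup>2 + b x + c)\<close> are \<open>2 y\<close> and \<open>-(3 x\<^sup>2 + 2 a x + b)\<close>;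
  the point at infinity is always smooth, since the homogeneous equation
  \<open>Y\<^sup>2 Z = X\<^sup>3 + a X\<^sup>2 Z + b X Z\<^sup>2 + c Z\<^sup>3\<close> has a nonzero \<open>Z\<close>-derivative at \<open>(0:1:0)\<close>.
\<close>

fun smooth_at :: "'a::field \<Rightarrow> 'a \<Rightarrow> 'a \<Rightarrow> 'a point \<Rightarrow> bool" where
  "smooth_at a b c Infinity = True"
| "smooth_at a b c (Affine x y) = (2 * y \<noteq> 0 \<or> poly (pderiv (rhs a b c)) x \<noteq> 0)"

definition smooth_points :: "'a::field \<Rightarrow> 'a \<Rightarrow> 'a \<Rightarrow> 'a point set" where
  "smooth_points a b c = {P \<in> points a b c. smooth_at a b c P}"

fun reflect :: "'a::field point \<Rightarrow> 'a point" where
  "reflect Infinity = Infinity"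
| "reflect (Affine x y) = Affine x (- y)"

text \<open>
  Slope of the line through two affine points, or of the tangent line if they coincide, when this
  line is not vertical.
\<close>

definition slope :: "'a::field \<Rightarrow> 'a \<Rightarrow> 'a \<Rightarrow> 'a \<Rightarrow> 'a \<Rightarrow> 'a \<Rightarrow> 'a \<Rightarrow> 'a" where
  "slope a b c x1 y1 x2 y2 =
     (if x1 = x2 then poly (pderiv (rhs a b c)) x1 / (2 * y1) else (y2 - y1) / (x2 - x1))"

text \<open>
  Third intersection point with the cubic of the line through \<open>P\<close> and \<open>Q\<close> (the tangent line if
  \<open>P = Q\<close>), for smooth points \<open>P\<close> and \<open>Q\<close>. The line at infinity is the tangent at \<open>Infinity\<close> and meets
  the cubic there three times; a line through \<open>Infinity\<close> and an affine point is vertical.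
  For a non-vertical line \<open>y = m (x - x1) + y1\<close> the first coordinates of the three intersection points
  are the roots of \<open>x\<^sup>3 + a x\<^sup>2 + b x + c - (m (x - x1) + y1)\<^sup>2\<close>, whose sum is \<open>m\<^sup>2 - a\<close>; see
  lemma \<open>line_cubic_factorization\<close> below.
\<close>

fun third_point :: "'a::field \<Rightarrow> 'a \<Rightarrow> 'a \<Rightarrow> 'a point \<Rightarrow> 'a point \<Rightarrow> 'a point" where
  "third_point a b c Infinity Q = reflect Q"
| "third_point a b c P Infinity = reflect P"
| "third_point a b c (Affine x1 y1) (Affine x2 y2) =
     (if x1 = x2 \<and> y1 = - y2 then Infinity
      else let m = slope a b c x1 y1 x2 y2; x3 = m\<^sup>2 - a - x1 - x2
           in Affine x3 (m * (x3 - x1) + y1))"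

text \<open>The sum of \<open>P\<close> and \<open>Q\<close> is the third point on the line through \<open>O\<close> and their third point.\<close>

definition chord_tangent_add :: "'a::field \<Rightarrow> 'a \<Rightarrow> 'a \<Rightarrow> 'a point \<Rightarrow> 'a point \<Rightarrow> 'a point" where
  "chord_tangent_add a b c P Q = third_point a b c Infinity (third_point a b c P Q)"

text \<open>
  The group law is usually written additively: \<open>n P\<close> is written as the power
  \<open>P [^] n\<close> of the \<open>monoid\<close> record.
\<close>

definition smooth_group :: "'a::field \<Rightarrow> 'a \<Rightarrow> 'a \<Rightarrow> 'a point monoid" where
  "smooth_group a b c =
     \<lparr>carrier = smooth_points a b c, mult = chord_tangent_add a b c, one = Infinity\<rparr>"

definition three_torsion_point :: "'a::field \<Rightarrow> 'a \<Rightarrow> 'a \<Rightarrow> 'a point \<Rightarrow> bool" where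
  "three_torsion_point a b c P \<longleftrightarrow>
     P \<in> carrier (smooth_group a b c) \<and>
     P [^]\<^bsub>smooth_group a b c\<^esub> (3::nat) = \<one>\<^bsub>smooth_group a b c\<^esub>"

definition two_division_quartic :: "'a::field \<Rightarrow> 'a \<Rightarrow> 'a \<Rightarrow> 'a \<Rightarrow> 'a poly" where
  "two_division_quartic a b c x2 =
     [:b\<^sup>2 - 4 * a * c - 4 * c * x2, - (8 * c + 4 * b * x2), - (2 * b + 4 * a * x2), - 4 * x2, 1:]"

lemma points_Affine_iff:
  "Affine x y \<in> points a b c \<longleftrightarrow> y\<^sup>2 = poly (rhs a b c) x"
  by (auto simp: points_def rhs_def power2_eq_square power3_eq_cube algebra_simps)

lemma line_cubic_factorization:
  fixes a b c :: "'a::field"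
  assumes char: "(2::'a) \<noteq> 0"
    and P: "Affine x1 y1 \<in> points a b c" and Q: "Affine x2 y2 \<in> points a b c"
    and nonvert: "\<not> (x1 = x2 \<and> y1 = - y2)"
  defines "m \<equiv> slope a b c x1 y1 x2 y2"
  shows "rhs a b c - [:y1 - m * x1, m:]\<^sup>2
       = [:- x1, 1:] * [:- x2, 1:] * [:- (m\<^sup>2 - a - x1 - x2), 1:]"
    and "m * (x2 - x1) + y1 = y2"
proof -
  have eq1: "y1\<^sup>2 = poly (rhs a b c) x1" and eq2: "y2\<^sup>2 = poly (rhs a b c) x2"
    using P Q by (simp_all add: points_Affine_iff)
  have c: "c = y1\<^sup>2 - x1 ^ 3 - a * x1\<^sup>2 - b * x1"
    using eq1 by (simp add: rhs_def power2_eq_square power3_eq_cube algebra_simps)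
  have "(m * (x2 - x1) + y1 = y2) \<and>
        b = (m\<^sup>2 - a) * (x1 + x2) - x1\<^sup>2 - x1 * x2 - x2\<^sup>2 - 2 * m * (m * x1 - y1)"
  proof (cases "x1 = x2")
    case True
    have "y1\<^sup>2 = y2\<^sup>2" using eq1 eq2 True by simp
    then have y: "y1 = y2" using nonvert True by (auto simp: power2_eq_iff)
    then have "2 * y1 \<noteq> 0"
      using nonvert True char by (metis add.inverse_neutral mult_eq_0_iff)
    then have "2 * m * y1 = poly (pderiv (rhs a b c)) x1"
      using True by (simp add: m_def slope_def field_simps)
    then have "b = 2 * m * y1 - 3 * x1\<^sup>2 - 2 * a * x1"
      by (simp add: rhs_def pderiv_pCons power2_eq_square algebra_simps)
    then show ?thesis using True y by (simp add: power2_eq_square algebra_simps)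
  next
    case False
    then have m: "m * (x2 - x1) + y1 = y2" by (simp add: m_def slope_def)
    have "y2\<^sup>2 - y1\<^sup>2 = (x2 - x1) * (x1\<^sup>2 + x1 * x2 + x2\<^sup>2 + a * (x1 + x2) + b)"
      using eq1 eq2 by (simp add: rhs_def power2_eq_square algebra_simps)
    moreover have "y2\<^sup>2 - y1\<^sup>2 = (x2 - x1) * (m * (m * (x2 - x1) + 2 * y1))"
      unfolding m[symmetric] by (simp add: power2_eq_square algebra_simps)
    ultimately have "x1\<^sup>2 + x1 * x2 + x2\<^sup>2 + a * (x1 + x2) + b = m * (m * (x2 - x1) + 2 * y1)"
      using False by simp
    then have "b = m * (m * (x2 - x1) + 2 * y1) - x1\<^sup>2 - x1 * x2 - x2\<^sup>2 - a * (x1 + x2)"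
      by (simp add: eq_diff_eq algebra_simps)
    then show ?thesis using m by (simp add: power2_eq_square algebra_simps)
  qed
  then have m: "m * (x2 - x1) + y1 = y2"
    and b: "b = (m\<^sup>2 - a) * (x1 + x2) - x1\<^sup>2 - x1 * x2 - x2\<^sup>2 - 2 * m * (m * x1 - y1)"
    by blast+
  show "m * (x2 - x1) + y1 = y2" by (fact m)
  have "c - (y1 - m * x1)\<^sup>2 = - (x1 * x2 * (m\<^sup>2 - a - x1 - x2))"
    using b c by algebra
  moreover have "b - 2 * m * (y1 - m * x1) = x1 * x2 + (x1 + x2) * (m\<^sup>2 - a - x1 - x2)"
    using b by algebra
  ultimately show "rhs a b c - [:y1 - m * x1, m:]\<^sup>2
       = [:- x1, 1:] * [:- x2, 1:] * [:- (m\<^sup>2 - a - x1 - x2), 1:]"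
    by (simp add: rhs_def power2_eq_square algebra_simps)
qed

lemma reflect_in_smooth_points:
  "P \<in> smooth_points a b c \<Longrightarrow> reflect P \<in> smooth_points a b c"
  by (cases P) (auto simp: smooth_points_def points_def)

lemma third_point_in_smooth_points:
  fixes a b c :: "'a::field"
  assumes char: "(2::'a) \<noteq> 0"
    and P: "P \<in> smooth_points a b c" and Q: "Q \<in> smooth_points a b c"
  shows "third_point a b c P Q \<in> smooth_points a b c"
proof (cases P)
  case Infinity
  then show ?thesis using Q by (simp add: reflect_in_smooth_points)
next
  case P': (Affine x1 y1)
  show ?thesis
  proof (cases Q)
    case Infinity
    then show ?thesis using P P' by (simp add: reflect_in_smooth_points[of "Affine x1 y1", simplified])
  next
    case Q': (Affine x2 y2)
    show ?thesis
    proof (cases "x1 = x2 \<and> y1 = - y2")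
      case True
      then show ?thesis using P' Q' by (simp add: smooth_points_def points_def)
    next
      case False
      define m where "m = slope a b c x1 y1 x2 y2"
      define x3 where "x3 = m\<^sup>2 - a - x1 - x2"
      define l where "l = [:y1 - m * x1, m:]"
      have onP: "Affine x1 y1 \<in> points a b c" and onQ: "Affine x2 y2 \<in> points a b c"
        using P Q P' Q' by (auto simp: smooth_points_def)
      have l1: "poly l x1 = y1" by (simp add: l_def)
      have l2: "poly l x2 = y2"
        using line_cubic_factorization(2)[OF char onP onQ False]
        by (simp add: l_def m_def algebra_simps)
      have fac: "rhs a b c - l\<^sup>2 = [:- x1, 1:] * [:- x2, 1:] * [:- x3, 1:]"
        unfolding l_def x3_def m_def using line_cubic_factorization(1)[OF char onP onQ False] .
      have "poly (rhs a b c - l\<^sup>2) x3 = 0" unfolding fac by simp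
      then have on3: "(poly l x3)\<^sup>2 = poly (rhs a b c) x3" by simp
      have "smooth_at a b c (Affine x3 (poly l x3))"
      proof (rule ccontr)
        assume "\<not> ?thesis"
        then have y0: "poly l x3 = 0" and f0: "poly (pderiv (rhs a b c)) x3 = 0"
          using char by auto
        have "poly (pderiv (rhs a b c - l\<^sup>2)) x3 = 0"
          by (simp add: pderiv_diff power2_eq_square pderiv_mult y0 f0)
        moreover have "poly (pderiv (rhs a b c - l\<^sup>2)) x3 = (x3 - x1) * (x3 - x2)"
          unfolding fac by (simp add: pderiv_mult pderiv_pCons algebra_simps)
        ultimately have "x3 = x1 \<or> x3 = x2" by simp
        then show False
          using y0 f0 l1 l2 P Q P' Q' by (auto simp: smooth_points_def)
      qed
      moreover have "poly l x3 = m * (x3 - x1) + y1" by (simp add: l_def algebra_simps)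
      then have "third_point a b c P Q = Affine x3 (poly l x3)"
        using False by (auto simp: P' Q' Let_def m_def x3_def)
      ultimately show ?thesis
        using on3 by (simp add: smooth_points_def points_Affine_iff)
    qed
  qed
qed

lemma third_point_commute:
  fixes a b c :: "'a::field"
  assumes char: "(2::'a) \<noteq> 0"
    and P: "P \<in> points a b c" and Q: "Q \<in> points a b c"
  shows "third_point a b c P Q = third_point a b c Q P"
proof (cases "P = Infinity \<or> Q = Infinity")
  case True
  then show ?thesis by (cases P; cases Q) auto
next
  case False
  then obtain x1 y1 x2 y2 where P': "P = Affine x1 y1" and Q': "Q = Affine x2 y2"
    by (meson point.exhaust)
  show ?thesis
  proof (cases "x1 = x2")
    case True
    have "y1\<^sup>2 = y2\<^sup>2" using P Q P' Q' True by (simp add: points_Affine_iff)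
    then have "y1 = y2 \<or> y1 = - y2" by (simp add: power2_eq_iff)
    then show ?thesis using True P' Q' by auto
  next
    case neq: False
    then have "slope a b c x1 y1 x2 y2 = slope a b c x2 y2 x1 y1"
      by (simp add: slope_def divide_simps) (simp add: algebra_simps)
    moreover have "slope a b c x1 y1 x2 y2 * (x2 - x1) + y1 = y2"
      using neq by (simp add: slope_def)
    then have "slope a b c x1 y1 x2 y2 * (x - x1) + y1 = slope a b c x1 y1 x2 y2 * (x - x2) + y2" for x
      by (simp add: algebra_simps)
    ultimately show ?thesis
      using neq by (simp add: P' Q' Let_def algebra_simps)
  qed
qed

end

theory Submission
  imports Defs
begin

text \<open>
  Write \<open>f = x\<^sup>3 + a x\<^sup>2 + b x + c\<close> for the cubic and \<open>P\<close> for the point \<open>(x\<^sub>2, y\<^sub>2)\<close>. Since \<open>2\<close> is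
  invertible, the number \<open>- d\<^sub>3 / 4\<close> is just \<open>x\<^sub>2\<close>, and because \<open>f(x\<^sub>2) = y\<^sub>2\<^sup>2\<close> the quartic \<open>q\<close> satisfies
  \<open>q(x\<^sub>2) = f'(x\<^sub>2)\<^sup>2 - 4 y\<^sub>2\<^sup>2 (3 x\<^sub>2 + a)\<close> and \<open>q'(x\<^sub>2) = - 8 y\<^sub>2\<^sup>2\<close>. Hence \<open>x\<^sub>2\<close> is a simple root exactly if
  \<open>y\<^sub>2 \<noteq> 0\<close> and \<open>q(x\<^sub>2) = 0\<close>.

  On the side of the group law, a point with \<open>y\<^sub>2 = 0\<close> is either singular or of order two, so it is
  never a 3-torsion point. If \<open>y\<^sub>2 \<noteq> 0\<close>, then \<open>P\<close> is smooth with tangent slope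
  \<open>m = f'(x\<^sub>2) / (2 y\<^sub>2)\<close>, and \<open>3 P = O\<close> says that \<open>P\<close> is a flex: the tangent meets the cubic three
  times at \<open>P\<close>. The remaining intersection has first coordinate \<open>m\<^sup>2 - a - 2 x\<^sub>2\<close>, so this means
  \<open>m\<^sup>2 = 3 x\<^sub>2 + a\<close>, which after clearing denominators is \<open>q(x\<^sub>2) = 0\<close>.
\<close>

lemma two_neq_0_if_CHAR_neq_2:
  assumes "CHAR('a::field) \<noteq> 2"
  shows "(2::'a) \<noteq> 0"
proof
  assume "(2::'a) = 0"
  then have "of_nat 2 = (0::'a)" by simp
  then have "CHAR('a) dvd 2" by (simp only: of_nat_eq_0_iff_char_dvd)
  then have "CHAR('a) = 1 \<or> CHAR('a) = 2" using prime_nat_iff two_is_prime_nat by blast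
  then show False using assms CHAR_not_1 by auto
qed

text \<open>
  In \<open>p = (X - x) r\<close> both conditions say \<open>r(x) \<noteq> 0\<close>, in every characteristic.
\<close>

lemma order_eq_1_iff_pderiv:
  fixes p :: "'a::field poly"
  assumes "p \<noteq> 0"
  shows "Polynomial.order x p = 1 \<longleftrightarrow> poly p x = 0 \<and> poly (pderiv p) x \<noteq> 0"
proof (cases "poly p x = 0")
  case True
  then obtain r where r: "p = [:- x, 1:] * r" by (auto simp: poly_eq_0_iff_dvd)
  then have "r \<noteq> 0" using assms by auto
  moreover have "Polynomial.order x p = 1 + Polynomial.order x r"
  proof -
    have "Polynomial.order x p = Polynomial.order x [:- x, 1:] + Polynomial.order x r"
      unfolding r by (rule order_mult) (use assms r in auto)
    also have "Polynomial.order x [:- x, 1:] = 1"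
      using order_power_n_n[of x 1] by simp
    finally show ?thesis .
  qed
  moreover have "poly (pderiv p) x = poly r x"
    unfolding r pderiv_mult by (simp add: pderiv_pCons)
  ultimately show ?thesis using True by (simp add: order_root)
next
  case False
  then show ?thesis by (simp add: order_0I)
qed

lemma poly_two_division_quartic_self:
  fixes a b c x y :: "'a::field"
  assumes "Affine x y \<in> points a b c"
  shows "poly (two_division_quartic a b c x) x
       = (poly (pderiv (rhs a b c)) x)\<^sup>2 - 4 * y\<^sup>2 * (3 * x + a)"
proof -
  have "y\<^sup>2 = c + x * (b + x * (a + x))"
    using assms by (simp add: points_Affine_iff rhs_def)
  then show ?thesis
    unfolding two_division_quartic_def rhs_def
    by (simp add: pderiv_pCons power2_eq_square algebra_simps)
qed

lemma poly_pderiv_two_division_quartic_self: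
  fixes a b c x y :: "'a::field"
  assumes "Affine x y \<in> points a b c"
  shows "poly (pderiv (two_division_quartic a b c x)) x = - 8 * y\<^sup>2"
proof -
  have "y\<^sup>2 = c + x * (b + x * (a + x))"
    using assms by (simp add: points_Affine_iff rhs_def)
  then show ?thesis
    unfolding two_division_quartic_def
    by (simp add: pderiv_pCons power2_eq_square algebra_simps)
qed

text \<open>
  The powers of the monoid are computed as \<open>((O + P) + P) + P\<close>, and a sum is \<open>O\<close> exactly if the
  summands are reflections of each other. So \<open>3 P = O\<close> becomes \<open>2 P = - P\<close>, that is, the tangent
  at \<open>P\<close> has \<open>P\<close> as its third intersection point as well.
\<close>

lemma three_torsion_point_Affine_iff:
  fixes a b c x y :: "'a::field"
  assumes two: "(2::'a) \<noteq> 0"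
    and P: "Affine x y \<in> points a b c"
  shows "three_torsion_point a b c (Affine x y) \<longleftrightarrow>
         y \<noteq> 0 \<and> (poly (pderiv (rhs a b c)) x)\<^sup>2 = 4 * y\<^sup>2 * (3 * x + a)"
proof -
  let ?P = "Affine x y" and ?f' = "poly (pderiv (rhs a b c)) x"
  have cube: "?P [^]\<^bsub>smooth_group a b c\<^esub> (3::nat)
      = chord_tangent_add a b c (chord_tangent_add a b c ?P ?P) ?P"
    by (simp add: smooth_group_def nat_pow_def numeral_3_eq_3 chord_tangent_add_def)
  show ?thesis
  proof (cases "y = 0")
    case True
    \<comment> \<open>Here \<open>P = - P\<close>, so the addition formulas give \<open>2 P = O\<close> and \<open>3 P = P\<close>, also if \<open>P\<close> is singular.\<close>
    then show ?thesis
      unfolding three_torsion_point_def cube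
      by (simp add: smooth_group_def chord_tangent_add_def)
  next
    case False
    then have nonvert: "y \<noteq> - y"
      using two by (metis add.right_inverse mult_2 mult_eq_0_iff)
    have smooth: "?P \<in> carrier (smooth_group a b c)"
      using P two False by (simp add: smooth_group_def smooth_points_def)
    define m where "m = ?f' / (2 * y)"
    define x3 where "x3 = m\<^sup>2 - a - x - x"
    have double: "chord_tangent_add a b c ?P ?P = Affine x3 (- (m * (x3 - x) + y))"
      using nonvert by (simp add: chord_tangent_add_def slope_def m_def x3_def Let_def)
    have "?P [^]\<^bsub>smooth_group a b c\<^esub> (3::nat) = Infinity \<longleftrightarrow> x3 = x"
      unfolding cube double by (auto simp: chord_tangent_add_def Let_def)
    also have "\<dots> \<longleftrightarrow> m\<^sup>2 = 3 * x + a"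
      unfolding x3_def by (auto simp: algebra_simps)
    also have "\<dots> \<longleftrightarrow> ?f'\<^sup>2 = 4 * y\<^sup>2 * (3 * x + a)"
    proof -
      have "?f' = 2 * y * m" using two False by (simp add: m_def)
      then have "?f'\<^sup>2 = (2 * y)\<^sup>2 * m\<^sup>2" by (simp add: power_mult_distrib)
      moreover have "4 * y\<^sup>2 * (3 * x + a) = (2 * y)\<^sup>2 * (3 * x + a)"
        by (simp add: power2_eq_square)
      moreover have "(2 * y)\<^sup>2 \<noteq> 0" by (rule power_not_zero) (use two False in simp)
      ultimately show ?thesis by (metis mult_cancel_left)
    qed
    finally show ?thesis
      using smooth False by (simp add: three_torsion_point_def smooth_group_def)
  qed
qed

theorem lemma4:
  fixes a b c x2 y2 d0 d1 d2 d3 :: "'a::field" and q :: "'a poly"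
  assumes char: "CHAR('a) \<noteq> 2"
    and P2: "Affine x2 y2 \<in> points a b c"
    and q: "q = [:d0, d1, d2, d3, 1:]"
    and quartic: "q = two_division_quartic a b c x2"
  shows "three_torsion_point a b c (Affine x2 y2) \<longleftrightarrow> Polynomial.order (- d3 / 4) q = 1"
proof -
  have two: "(2::'a) \<noteq> 0" using char by (rule two_neq_0_if_CHAR_neq_2)
  have "(4::'a) = 2 * 2" and "(8::'a) = 2 * 2 * 2" by simp_all
  then have four: "(4::'a) \<noteq> 0" and eight: "(8::'a) \<noteq> 0"
    using two by (metis mult_eq_0_iff)+
  have "d3 = - 4 * x2" using q quartic by (simp add: two_division_quartic_def)
  then have x2: "- d3 / 4 = x2" using four by simp
  have "q \<noteq> 0" using q by simp
  then have "Polynomial.order (- d3 / 4) q = 1 \<longleftrightarrow> poly q x2 = 0 \<and> poly (pderiv q) x2 \<noteq> 0"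
    unfolding x2 by (rule order_eq_1_iff_pderiv)
  also have "\<dots> \<longleftrightarrow>
      y2 \<noteq> 0 \<and> (poly (pderiv (rhs a b c)) x2)\<^sup>2 = 4 * y2\<^sup>2 * (3 * x2 + a)"
    unfolding quartic poly_two_division_quartic_self[OF P2]
      poly_pderiv_two_division_quartic_self[OF P2]
    using eight by auto
  finally show ?thesis using three_torsion_point_Affine_iff[OF two P2] by simp
qed

end
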